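(* For any vector space $A$, the collection of spaces $\mathcal O_A=\{\mathcal O_A(n)\}_{n\ge1}$, $\mathcal O_A(n)=\mathrm{Hom}(\mathbb K[C_n]\otimes A^{\otimes n},A)$, with the partial compositions $\circ_i:\mathcal O_A(m)\otimes\mathcal O_A(n)\to\mathcal O_A(m+n-1)$, $m,n\ge1$, $1\le i\le m$, defined in the context, is a non-symmetric operad with identity element $\mathrm{id}\in\mathcal O_A(1)$ given by $\mathrm{id}([1];a)=a$ for all $a\in A$. Moreover, an NS-algebra structure on $A$ is equivalent to a multiplication $\pi\in\mathcal O_A(2)$ on the operad $\mathcal O_A$ (i.e. an element $\pi\in\mathcal O_A(2)$ satisfying $\pi\circ_1\pi=\pi\circ_2\pi$), under the correspondence $a\prec b=\pi([1];a,b)$, $a\succ b=\pi([2];a,b)$, $a\curlyvee b=\pi([3];a,b)$.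
   Context: All vector spaces and linear maps are over a field $\mathbb K$ of characteristic $0$. $C_1=\{[1]\}$ and $C_n=\{[1],\ldots,[n],[n+1]\}$ for $n\ge2$; $\mathbb K[C_n]$ is the vector space with basis $C_n$. Write $f([r];a_1,\ldots,a_n)$ for the value of $f\in\mathcal O_A(n)$, extended linearly in the first argument. Convention for arity one: for $f\in\mathcal O_A(1)$, $f([2];\cdot)$ is read as $0$. For $f\in\mathcal O_A(m)$, $g\in\mathcal O_A(n)$, $1\le i\le m$ and $[r]\in C_{m+n-1}$, write $g_{s}=g(s;a_i,\ldots,a_{i+n-1})$ for $s\in\mathbb K[C_n]$ and $\Sigma=[1]+\cdots+[n+1]$. Then $(f\circ_ig)([r];a_1,\ldots,a_{m+n-1})$ equals - $f([r];a_1,\ldots,a_{i-1},g_{\Sigma},a_{i+n},\ldots,a_{m+n-1})$ if $1\le r\le i-1$; - $f([i];a_1,\ldots,a_{i-1},g_{[r-i+1]},a_{i+n},\ldots,a_{m+n-1})$ if $i\le r\le i+n-1$; - $f([r-n+1];a_1,\ldots,a_{i-1},g_{\Sigma},a_{i+n},\ldots,a_{m+n-1})$ if $i+n\le r\le m+n-1$; - $f([i];a_1,\ldots,a_{i-1},g_{[n+1]},a_{i+n},\ldots,a_{m+n-1})+f([m+1];a_1,\ldots,a_{i-1},g_{\Sigma},a_{i+n},\ldots,a_{m+n-1})$ if $r=m+n$ (this case occurring only when $m+n-1\ge2$). A non-symmetric operad here means: $(f\circ_ig)\circ_{i+j-1}h=f\circ_i(g\circ_jh)$ for $1\le i\le m$,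 $1\le j\le n$; $(f\circ_ig)\circ_{j+n-1}h=(f\circ_jh)\circ_ig$ for $1\le i<j\le m$ (with $f\in\mathcal O_A(m)$, $g\in\mathcal O_A(n)$, $h\in\mathcal O_A(p)$); and $f\circ_i\mathrm{id}=f=\mathrm{id}\circ_1f$. An NS-algebra is a vector space $A$ with bilinear operations $\prec,\succ,\curlyvee$ such that, with $a*b=a\prec b+a\succ b+a\curlyvee b$, for all $a,b,c$: $(a\prec b)\prec c=a\prec(b*c)$; $(a\succ b)\prec c=a\succ(b\prec c)$; $(a*b)\succ c=a\succ(b\succ c)$; $(a\curlyvee b)\prec c+(a*b)\curlyvee c=a\succ(b\curlyvee c)+a\curlyvee(b*c)$. *)

theory Defs
  imports Complex_Main "HOL-Library.Poly_Mapping" "HOL-Library.Function_Algebras"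
begin

text \<open>
  Partial compositions do not determine the arities of their arguments (the zero map lies in every
  arity), so \<open>comp m n i f g\<close> denotes \<open>f \<circ>\<^sub>i g\<close> for \<open>f \<in> P m\<close> and \<open>g \<in> P n\<close>. The three linearity
  axioms express that \<open>\<circ>\<^sub>i\<close> is defined on \<open>P m \<otimes> P n\<close>; \<open>P 0\<close> plays no role.
\<close>

locale ns_operad = vector_space sc
  for sc :: "'k::field \<Rightarrow> 'p::ab_group_add \<Rightarrow> 'p" +
  fixes P :: "nat \<Rightarrow> 'p set"
    and comp :: "nat \<Rightarrow> nat \<Rightarrow> nat \<Rightarrow> 'p \<Rightarrow> 'p \<Rightarrow> 'p"
    and e :: "'p"
  assumes subspace_P: "1 \<le> n \<Longrightarrow> subspace (P n)"
    and comp_closed: "\<lbrakk>1 \<le> m; 1 \<le> n; 1 \<le> i; i \<le> m; f \<in> P m; g \<in> P n\<rbrakk>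
      \<Longrightarrow> comp m n i f g \<in> P (m + n - 1)"
    and comp_add_left: "\<lbrakk>1 \<le> m; 1 \<le> n; 1 \<le> i; i \<le> m; f \<in> P m; f' \<in> P m; g \<in> P n\<rbrakk>
      \<Longrightarrow> comp m n i (f + f') g = comp m n i f g + comp m n i f' g"
    and comp_add_right: "\<lbrakk>1 \<le> m; 1 \<le> n; 1 \<le> i; i \<le> m; f \<in> P m; g \<in> P n; g' \<in> P n\<rbrakk>
      \<Longrightarrow> comp m n i f (g + g') = comp m n i f g + comp m n i f g'"
    and comp_scale: "\<lbrakk>1 \<le> m; 1 \<le> n; 1 \<le> i; i \<le> m; f \<in> P m; g \<in> P n\<rbrakk>
      \<Longrightarrow> comp m n i (sc c f) g = sc c (comp m n i f g)
        \<and> comp m n i f (sc c g) = sc c (comp m n i f g)"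
    and comp_seq: "\<lbrakk>1 \<le> m; 1 \<le> n; 1 \<le> p; 1 \<le> i; i \<le> m; 1 \<le> j; j \<le> n;
        f \<in> P m; g \<in> P n; h \<in> P p\<rbrakk>
      \<Longrightarrow> comp (m + n - 1) p (i + j - 1) (comp m n i f g) h
        = comp m (n + p - 1) i f (comp n p j g h)"
    and comp_par: "\<lbrakk>1 \<le> m; 1 \<le> n; 1 \<le> p; 1 \<le> i; i < j; j \<le> m;
        f \<in> P m; g \<in> P n; h \<in> P p\<rbrakk>
      \<Longrightarrow> comp (m + n - 1) p (j + n - 1) (comp m n i f g) h
        = comp (m + p - 1) n i (comp m p j f h) g"
    and unit_closed: "e \<in> P 1"
    and comp_unit_right: "\<lbrakk>1 \<le> m; 1 \<le> i; i \<le> m; f \<in> P m\<rbrakk> \<Longrightarrow> comp m 1 i f e = f"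
    and comp_unit_left: "\<lbrakk>1 \<le> m; f \<in> P m\<rbrakk> \<Longrightarrow> comp 1 m 1 e f = f"

definition C :: "nat \<Rightarrow> nat set" where
  "C n = (if n = 1 then {1} else {1..n + 1})"

definition basis_vec :: "nat \<Rightarrow> nat \<Rightarrow>\<^sub>0 'k::field" where
  "basis_vec r = Poly_Mapping.single r 1"

definition free_scale :: "'k::field \<Rightarrow> (nat \<Rightarrow>\<^sub>0 'k) \<Rightarrow> (nat \<Rightarrow>\<^sub>0 'k)" where
  "free_scale c s = Poly_Mapping.map ((*) c) s"

lemma lookup_free_scale: "Poly_Mapping.lookup (free_scale c s) r = c * Poly_Mapping.lookup s r"
  by (simp add: free_scale_def Poly_Mapping.map.rep_eq when_def)

lemma vector_space_free_scale: "vector_space free_scale"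
  by unfold_locales
    (auto intro!: poly_mapping_eqI simp: lookup_free_scale lookup_add algebra_simps)

definition Sigma_vec :: "nat \<Rightarrow> nat \<Rightarrow>\<^sub>0 'k::field" where
  "Sigma_vec n = (\<Sum>r = 1..n + 1. basis_vec r)"

type_synonym ('k, 'a) cochain = "(nat \<Rightarrow>\<^sub>0 'k) \<Rightarrow> 'a list \<Rightarrow> 'a"

text \<open>
  \<open>f s [a\<^sub>1,\<dots>,a\<^sub>n]\<close> is the value of \<open>f \<in> Hom(K[C\<^sub>n] \<otimes> A\<^sup>\<otimes>\<^sup>n, A)\<close> at \<open>s \<otimes> a\<^sub>1 \<otimes> \<dots> \<otimes> a\<^sub>n\<close>;
  by the universal property of the tensor product, such \<open>f\<close> are the maps linear in \<open>s\<close> and in each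
  \<open>a\<^sub>j\<close>. To make \<open>f\<close> total, it is extended by zero: to lists of length other than \<open>n\<close>, and, linearly
  in \<open>s\<close>, from \<open>K[C\<^sub>n]\<close> to the free space on all of \<open>\<nat>\<close> by \<open>f [r] = 0\<close> for \<open>r \<notin> C\<^sub>n\<close>. Hence equality of
  functions is equality in \<open>Hom(K[C\<^sub>n] \<otimes> A\<^sup>\<otimes>\<^sup>n, A)\<close>, and for \<open>n = 1\<close> the value at \<open>[2]\<close> is \<open>0\<close>.
\<close>

definition OA :: "('k::field \<Rightarrow> 'a::ab_group_add \<Rightarrow> 'a) \<Rightarrow> nat \<Rightarrow> ('k, 'a) cochain set" where
  "OA scale n = {f.
     (\<forall>s as. length as \<noteq> n \<longrightarrow> f s as = 0) \<and>
     (\<forall>r as. r \<notin> C n \<longrightarrow> f (basis_vec r) as = 0) \<and>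
     (\<forall>as. length as = n \<longrightarrow> Vector_Spaces.linear free_scale scale (\<lambda>s. f s as)) \<and>
     (\<forall>s as j. length as = n \<longrightarrow> j < n \<longrightarrow>
        Vector_Spaces.linear scale scale (\<lambda>x. f s (as[j := x])))}"

definition OA_scale :: "('k::field \<Rightarrow> 'a::ab_group_add \<Rightarrow> 'a) \<Rightarrow> 'k \<Rightarrow> ('k, 'a) cochain \<Rightarrow> ('k, 'a) cochain"
  where "OA_scale scale c f = (\<lambda>s as. scale c (f s as))"

text \<open>
  \<open>comp_basis m n i f g r as\<close> is the value of \<open>f \<circ>\<^sub>i g\<close> at \<open>([r]; as)\<close>, where \<open>F t s\<close> stands for
  \<open>f(t; a\<^sub>1,\<dots>, g(s; \<dots>),\<dots>)\<close>.
\<close>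

definition comp_basis ::
  "nat \<Rightarrow> nat \<Rightarrow> nat \<Rightarrow> ('k::field, 'a::ab_group_add) cochain \<Rightarrow> ('k, 'a) cochain \<Rightarrow> nat \<Rightarrow> 'a list \<Rightarrow> 'a"
  where "comp_basis m n i f g r as =
    (let F = (\<lambda>t s. f t (take (i - 1) as @ [g s (take n (drop (i - 1) as))] @ drop (i - 1 + n) as))
     in if 1 \<le> r \<and> r \<le> i - 1 then F (basis_vec r) (Sigma_vec n)
        else if i \<le> r \<and> r \<le> i + n - 1 then F (basis_vec i) (basis_vec (r - i + 1))
        else if i + n \<le> r \<and> r \<le> m + n - 1 then F (basis_vec (r - n + 1)) (Sigma_vec n)
        else if r = m + n \<and> 2 \<le> m + n - 1 then
          F (basis_vec i) (basis_vec (n + 1)) + F (basis_vec (m + 1)) (Sigma_vec n)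
        else 0)"

definition OA_comp ::
  "('k::field \<Rightarrow> 'a::ab_group_add \<Rightarrow> 'a) \<Rightarrow> nat \<Rightarrow> nat \<Rightarrow> nat
    \<Rightarrow> ('k, 'a) cochain \<Rightarrow> ('k, 'a) cochain \<Rightarrow> ('k, 'a) cochain"
  where "OA_comp scale m n i f g = (\<lambda>s as.
    if length as = m + n - 1
    then \<Sum>r\<in>Poly_Mapping.keys s. scale (Poly_Mapping.lookup s r) (comp_basis m n i f g r as)
    else 0)"

definition OA_id :: "('k::field \<Rightarrow> 'a::ab_group_add \<Rightarrow> 'a) \<Rightarrow> ('k, 'a) cochain" where
  "OA_id scale = (\<lambda>s as. if length as = 1 then scale (Poly_Mapping.lookup s 1) (hd as) else 0)"

lemma OA_comp_basis_vec:
  assumes "vector_space scale" and "length as = m + n - 1"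
  shows "OA_comp scale m n i f g (basis_vec r) as = comp_basis m n i f g r as"
proof -
  interpret vector_space scale by fact
  show ?thesis using assms(2) by (simp add: OA_comp_def basis_vec_def)
qed

lemma OA_id_basis_vec:
  assumes "vector_space scale"
  shows "OA_id scale (basis_vec 1) [a] = a"
proof -
  interpret vector_space scale by fact
  show ?thesis by (simp add: OA_id_def basis_vec_def)
qed

definition bilinear_op ::
  "('k::field \<Rightarrow> 'a::ab_group_add \<Rightarrow> 'a) \<Rightarrow> ('a \<Rightarrow> 'a \<Rightarrow> 'a) \<Rightarrow> bool" where
  "bilinear_op scale b \<longleftrightarrow>
     (\<forall>x. Vector_Spaces.linear scale scale (\<lambda>y. b x y)) \<and>
     (\<forall>y. Vector_Spaces.linear scale scale (\<lambda>x. b x y))"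

locale ns_algebra = vector_space scale
  for scale :: "'k::field \<Rightarrow> 'a::ab_group_add \<Rightarrow> 'a" +
  fixes nsl :: "'a \<Rightarrow> 'a \<Rightarrow> 'a" (infixl "\<prec>" 70)
    and nsr :: "'a \<Rightarrow> 'a \<Rightarrow> 'a" (infixl "\<succ>" 70)
    and nsv :: "'a \<Rightarrow> 'a \<Rightarrow> 'a" (infixl "\<curlyvee>" 70)
  assumes bilinear_nsl: "bilinear_op scale (\<prec>)"
    and bilinear_nsr: "bilinear_op scale (\<succ>)"
    and bilinear_nsv: "bilinear_op scale (\<curlyvee>)"
    and ns1: "(a \<prec> b) \<prec> c = a \<prec> (b \<prec> c + b \<succ> c + b \<curlyvee> c)"
    and ns2: "(a \<succ> b) \<prec> c = a \<succ> (b \<prec> c)"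
    and ns3: "(a \<prec> b + a \<succ> b + a \<curlyvee> b) \<succ> c = a \<succ> (b \<succ> c)"
    and ns4: "(a \<curlyvee> b) \<prec> c + (a \<prec> b + a \<succ> b + a \<curlyvee> b) \<curlyvee> c
      = a \<succ> (b \<curlyvee> c) + a \<curlyvee> (b \<prec> c + b \<succ> c + b \<curlyvee> c)"

end

theory Submission
  imports Defs
begin

text \<open>
  A cochain is determined by its values at basis vectors, so the operad axioms can be checked there.
  The key point is that evaluation at \<open>\<Sigma>\<close> is multiplicative,
  \<open>(f \<circ>\<^sub>i g)(\<Sigma>; \<dots>) = f(\<Sigma>; \<dots>, g(\<Sigma>; \<dots>), \<dots>)\<close>, so that in every range of \<open>r\<close> both sides of
  an axiom insert the same basis vectors and the same \<open>\<Sigma>\<close>'s. For \<open>\<pi> \<in> \<O>\<^sub>A(2)\<close>, the equation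
  \<open>\<pi> \<circ>\<^sub>1 \<pi> = \<pi> \<circ>\<^sub>2 \<pi>\<close> at \<open>[1], \<dots>, [4]\<close> is the list of the four NS-algebra identities.
\<close>

section \<open>Linear maps out of the free space, and splitting of argument lists\<close>

lemma linearD:
  assumes "Vector_Spaces.linear s1 s2 L"
  shows linearD_add: "L (x + y) = L x + L y"
    and linearD_scale: "L (s1 c x) = s2 c (L x)"
    and linearD_zero: "L 0 = 0"
    and linearD_sum: "L (sum u I) = (\<Sum>i\<in>I. L (u i))"
proof -
  interpret L: Vector_Spaces.linear s1 s2 L by fact
  show "L (x + y) = L x + L y" "L (s1 c x) = s2 c (L x)" "L 0 = 0"
    "L (sum u I) = (\<Sum>i\<in>I. L (u i))"
    by (simp_all add: L.add L.scale L.sum)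
qed

lemma lookup_basis_vec: "Poly_Mapping.lookup (basis_vec r) k = (1 when r = k)"
  by (simp add: basis_vec_def lookup_single)

lemma sum_basis_vec:
  "(\<Sum>r\<in>Poly_Mapping.keys s. free_scale (Poly_Mapping.lookup s r) (basis_vec r)) = s"
proof (rule poly_mapping_eqI)
  fix k
  have "Poly_Mapping.lookup
      (\<Sum>r\<in>Poly_Mapping.keys s. free_scale (Poly_Mapping.lookup s r) (basis_vec r)) k
    = (\<Sum>r\<in>Poly_Mapping.keys s. if r = k then Poly_Mapping.lookup s r else 0)"
    by (simp add: lookup_sum lookup_free_scale lookup_basis_vec when_def if_distrib cong: if_cong)
  also have "\<dots> = Poly_Mapping.lookup s k"
    by (simp add: sum.delta' in_keys_iff)
  finally show "Poly_Mapping.lookup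
      (\<Sum>r\<in>Poly_Mapping.keys s. free_scale (Poly_Mapping.lookup s r) (basis_vec r)) k
    = Poly_Mapping.lookup s k" .
qed

lemma linear_free_expand:
  assumes "Vector_Spaces.linear free_scale scale L"
  shows "L s = (\<Sum>r\<in>Poly_Mapping.keys s. scale (Poly_Mapping.lookup s r) (L (basis_vec r)))"
proof -
  have "L s = L (\<Sum>r\<in>Poly_Mapping.keys s. free_scale (Poly_Mapping.lookup s r) (basis_vec r))"
    by (simp add: sum_basis_vec)
  also have "\<dots> = (\<Sum>r\<in>Poly_Mapping.keys s. scale (Poly_Mapping.lookup s r) (L (basis_vec r)))"
    using assms by (simp only: linearD_sum[OF assms] linearD_scale[OF assms])
  finally show ?thesis .
qed

text \<open>Cuts an argument list into the entries before, inside and after an inserted operation;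
  two uses give the five blocks of a double composition.\<close>

lemma split_append3:
  assumes "length as = a + b + c"
  obtains xs ys zs where "as = xs @ ys @ zs" "length xs = a" "length ys = b" "length zs = c"
proof
  show "as = take a as @ take b (drop a as) @ drop b (drop a as)"
    by (simp only: append_take_drop_id)
qed (use assms in auto)

lemma C_iff: "1 \<le> n \<Longrightarrow> r \<in> C n \<longleftrightarrow> 1 \<le> r \<and> (r \<le> n \<or> r = n + 1 \<and> 2 \<le> n)"
  by (auto simp: C_def)

section \<open>Linearity criteria over a fixed vector space\<close>

locale cochain_space = vector_space scale
  for scale :: "'k::field \<Rightarrow> 'a::ab_group_add \<Rightarrow> 'a" (infixr "*s" 75)
begin

lemma linear_free_iff:
  "Vector_Spaces.linear free_scale scale L \<longleftrightarrow>
    (\<forall>x y. L (x + y) = L x + L y) \<and> (\<forall>c x. L (free_scale c x) = c *s L x)"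
  using vector_space_free_scale vector_space_axioms by (auto simp: Vector_Spaces.linear_iff)

lemma linear_self_iff:
  "Vector_Spaces.linear scale scale L \<longleftrightarrow>
    (\<forall>x y. L (x + y) = L x + L y) \<and> (\<forall>c x. L (c *s x) = c *s L x)"
  using vector_space_axioms by (auto simp: Vector_Spaces.linear_iff)

lemma linear_self_zero: "Vector_Spaces.linear scale scale (\<lambda>x. 0)"
  by (simp add: linear_self_iff)

lemma linear_self_add:
  assumes "Vector_Spaces.linear scale scale L" "Vector_Spaces.linear scale scale L'"
  shows "Vector_Spaces.linear scale scale (\<lambda>x. L x + L' x)"
  using assms by (simp add: linear_self_iff scale_right_distrib)

text \<open>The condition is independent of \<open>x\<close>, so a definition by cases on an index
  can be treated branch by branch.\<close>

lemma linear_self_if: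
  assumes "Vector_Spaces.linear scale scale L" "Vector_Spaces.linear scale scale L'"
  shows "Vector_Spaces.linear scale scale (\<lambda>x. if b then L x else L' x)"
  using assms by (cases b) simp_all

text \<open>The support of \<open>s\<close> varies with \<open>s\<close>. Summing over a common
  finite set, where the extra coefficients vanish, makes additivity a termwise matter.\<close>

lemma sum_keys_superset:
  assumes "finite K" "Poly_Mapping.keys s \<subseteq> K"
  shows "(\<Sum>r\<in>Poly_Mapping.keys s. Poly_Mapping.lookup s r *s v r)
    = (\<Sum>r\<in>K. Poly_Mapping.lookup s r *s v r)"
  using assms by (intro sum.mono_neutral_left) (auto simp: in_keys_iff)

lemma linear_sum_keys:
  "Vector_Spaces.linear free_scale scale
    (\<lambda>s. \<Sum>r\<in>Poly_Mapping.keys s. Poly_Mapping.lookup s r *s v r)"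
proof -
  have "(\<Sum>r\<in>Poly_Mapping.keys (s + t). Poly_Mapping.lookup (s + t) r *s v r)
      = (\<Sum>r\<in>Poly_Mapping.keys s. Poly_Mapping.lookup s r *s v r)
        + (\<Sum>r\<in>Poly_Mapping.keys t. Poly_Mapping.lookup t r *s v r)" for s t
  proof -
    let ?K = "Poly_Mapping.keys s \<union> Poly_Mapping.keys t"
    show ?thesis
      using sum_keys_superset[of ?K "s + t"] sum_keys_superset[of ?K s] sum_keys_superset[of ?K t]
        Poly_Mapping.keys_add[of s t]
      by (simp add: lookup_add scale_left_distrib sum.distrib)
  qed
  moreover have "(\<Sum>r\<in>Poly_Mapping.keys (free_scale c s). Poly_Mapping.lookup (free_scale c s) r *s v r)
      = c *s (\<Sum>r\<in>Poly_Mapping.keys s. Poly_Mapping.lookup s r *s v r)" for c s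
  proof -
    have "Poly_Mapping.keys (free_scale c s) \<subseteq> Poly_Mapping.keys s"
      by (auto simp: in_keys_iff lookup_free_scale)
    then show ?thesis
      using sum_keys_superset[of "Poly_Mapping.keys s" "free_scale c s"]
      by (simp add: lookup_free_scale scale_sum_right)
  qed
  ultimately show ?thesis
    by (simp add: linear_free_iff)
qed

section \<open>Cochains and their values at basis vectors\<close>

lemma OA_length: "f \<in> OA scale n \<Longrightarrow> length as \<noteq> n \<Longrightarrow> f s as = 0"
  by (simp add: OA_def)

lemma OA_not_C: "f \<in> OA scale n \<Longrightarrow> r \<notin> C n \<Longrightarrow> f (basis_vec r) as = 0"
  by (simp add: OA_def)

text \<open>For lists of the wrong length the map is zero, hence still linear, so later uses carry
  no length condition.\<close>

lemma OA_linear_vec: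
  assumes "f \<in> OA scale n"
  shows "Vector_Spaces.linear free_scale scale (\<lambda>s. f s as)"
  using assms by (cases "length as = n") (simp_all add: OA_def linear_free_iff)

lemma OA_linear_update:
  assumes "f \<in> OA scale n" "j < length as"
  shows "Vector_Spaces.linear scale scale (\<lambda>x. f s (as[j := x]))"
  using assms by (cases "length as = n") (simp_all add: OA_def linear_self_iff)

text \<open>The slot is marked by the surrounding lists instead of an index: this is how a value of
  \<open>g\<close> occurs inside \<open>f\<close>.\<close>

lemma OA_linear_entry:
  assumes "f \<in> OA scale n"
  shows "Vector_Spaces.linear scale scale (\<lambda>x. f s (xs @ x # zs))"
  using OA_linear_update[OF assms, of "length xs" "xs @ 0 # zs" s] by simp

lemma OA_expand:
  assumes "f \<in> OA scale n"
  shows "f s as = (\<Sum>r\<in>Poly_Mapping.keys s. Poly_Mapping.lookup s r *s f (basis_vec r) as)"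
  by (rule linear_free_expand[OF OA_linear_vec[OF assms]])

lemma OA_Sigma:
  assumes "f \<in> OA scale n"
  shows "f (Sigma_vec n) as = (\<Sum>r = 1..n + 1. f (basis_vec r) as)"
  unfolding Sigma_vec_def by (rule linearD_sum[OF OA_linear_vec[OF assms]])

text \<open>Linearity in the first argument reduces equality to basis vectors; lists of wrong length
  and indices outside \<open>C n\<close> give zero on both sides.\<close>

lemma OA_eqI:
  assumes "f \<in> OA scale n" "g \<in> OA scale n" "1 \<le> n"
    and "\<And>r as. 1 \<le> r \<Longrightarrow> r \<le> n + 1 \<Longrightarrow> length as = n \<Longrightarrow> f (basis_vec r) as = g (basis_vec r) as"
  shows "f = g"
proof (intro ext)
  fix s as
  have "f (basis_vec r) as = g (basis_vec r) as" for r
  proof (cases "length as = n \<and> r \<in> C n")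
    case True
    then show ?thesis using assms(3) assms(4)[of r as] by (auto simp: C_iff)
  next
    case False
    then show ?thesis
      using assms(1,2) OA_length[of f n as] OA_length[of g n as] OA_not_C[of f n r] OA_not_C[of g n r]
      by auto
  qed
  then show "f s as = g s as"
    by (simp add: OA_expand[OF assms(1), of s as] OA_expand[OF assms(2), of s as])
qed

section \<open>Partial composition is well defined\<close>

lemma OA_comp_length: "length as \<noteq> m + n - 1 \<Longrightarrow> OA_comp scale m n i f g s as = 0"
  by (simp add: OA_comp_def)

lemma OA_comp_linear_vec:
  "Vector_Spaces.linear free_scale scale (\<lambda>s. OA_comp scale m n i f g s as)"
proof (cases "length as = m + n - 1")
  case True
  then show ?thesis by (simp add: OA_comp_def linear_sum_keys)
qed (simp add: OA_comp_def linear_free_iff)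

text \<open>An entry outside the block fed to \<open>g\<close> is directly an argument of
  \<open>f\<close>; for an entry inside it, the map is a linear map given by \<open>g\<close>
  followed by one given by \<open>f\<close>.\<close>

lemma comp_basis_linear_update:
  assumes f: "f \<in> OA scale m" and g: "g \<in> OA scale n"
    and "1 \<le> i" "i \<le> m" "length as = m + n - 1" "j < m + n - 1"
  shows "Vector_Spaces.linear scale scale (\<lambda>x. comp_basis m n i f g r (as[j := x]))"
proof -
  define F where "F t s bs = f t (take (i - 1) bs @ [g s (take n (drop (i - 1) bs))]
      @ drop (i - 1 + n) bs)" for t s bs
  have lin: "Vector_Spaces.linear scale scale (\<lambda>x. F t s (as[j := x]))" for t s
  proof -
    consider "j < i - 1" | "i - 1 \<le> j" "j < i - 1 + n" | "i - 1 + n \<le> j" by linarith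
    then show ?thesis
    proof cases
      case 1
      have "F t s (as[j := x]) = f t ((take (i - 1) as @ [g s (take n (drop (i - 1) as))]
          @ drop (i - 1 + n) as)[j := x])" for x
        using 1 assms by (simp add: F_def take_update_swap list_update_append)
      then show ?thesis
        using OA_linear_update[OF f] assms 1 by simp
    next
      case 2
      have eq: "F t s (as[j := x]) = f t (take (i - 1) as
          @ g s ((take n (drop (i - 1) as))[j - (i - 1) := x]) # drop (i - 1 + n) as)" for x
      proof -
        have "take (i - 1) (as[j := x]) = take (i - 1) as"
          and "drop (i - 1 + n) (as[j := x]) = drop (i - 1 + n) as"
          using 2 by simp_all
        moreover have "take n (drop (i - 1) (as[j := x]))
            = (take n (drop (i - 1) as))[j - (i - 1) := x]"
          using 2 by (simp add: drop_update_swap take_update_swap)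
        ultimately show ?thesis by (simp add: F_def)
      qed
      have "Vector_Spaces.linear scale scale (\<lambda>x. g s ((take n (drop (i - 1) as))[j - (i - 1) := x]))"
        using 2 assms by (intro OA_linear_update[OF g]) auto
      from Vector_Spaces.linear_compose[OF this OA_linear_entry[OF f]] show ?thesis
        unfolding eq by (simp add: o_def)
    next
      case 3
      \<comment> \<open>A single value of \<open>g\<close> replaces \<open>n\<close> entries, so the
        entry at position \<open>j\<close> moves to \<open>j + 1 - n\<close>.\<close>
      have "F t s (as[j := x]) = f t ((take (i - 1) as @ [g s (take n (drop (i - 1) as))]
          @ drop (i - 1 + n) as)[j + 1 - n := x])" for x
      proof -
        have "take n (drop (i - 1) (as[j := x])) = take n (drop (i - 1) as)"
          using 3 by (simp add: drop_update_swap)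
        moreover have "take (i - 1) (as[j := x]) = take (i - 1) as"
          using 3 by simp
        moreover have "drop (i - 1 + n) (as[j := x]) = (drop (i - 1 + n) as)[j - (i - 1 + n) := x]"
          using 3 by (simp add: drop_update_swap)
        moreover have "length (take (i - 1) as) = i - 1" "\<not> j + 1 - n < i - 1"
          and "j + 1 - n - (i - 1) = Suc (j - (i - 1 + n))"
          using 3 assms by auto
        ultimately show ?thesis
          by (simp only: F_def list_update_append if_False append_Cons append_Nil
              list_update.simps nat.case)
      qed
      then show ?thesis
        using OA_linear_update[OF f] assms 3 by simp
    qed
  qed
  \<comment> \<open>The branch is chosen by \<open>r\<close> alone, so the varied entry enters only
    through \<open>F\<close>.\<close>
  have cb: "comp_basis m n i f g r bs =
     (if 1 \<le> r \<and> r \<le> i - 1 then F (basis_vec r) (Sigma_vec n) bs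
        else if i \<le> r \<and> r \<le> i + n - 1 then F (basis_vec i) (basis_vec (r - i + 1)) bs
        else if i + n \<le> r \<and> r \<le> m + n - 1 then F (basis_vec (r - n + 1)) (Sigma_vec n) bs
        else if r = m + n \<and> 2 \<le> m + n - 1 then
          F (basis_vec i) (basis_vec (n + 1)) bs + F (basis_vec (m + 1)) (Sigma_vec n) bs
        else 0)" for bs
    by (simp add: comp_basis_def F_def Let_def)
  show ?thesis
    unfolding cb by (intro linear_self_if linear_self_add lin linear_self_zero)
qed

lemma OA_comp_linear_update:
  assumes "f \<in> OA scale m" "g \<in> OA scale n"
    and "1 \<le> i" "i \<le> m" "length as = m + n - 1" "j < m + n - 1"
  shows "Vector_Spaces.linear scale scale (\<lambda>x. OA_comp scale m n i f g s (as[j := x]))"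
proof -
  note lin = comp_basis_linear_update[OF assms]
  show ?thesis
    using assms(5)
    by (simp add: OA_comp_def linear_self_iff linearD_add[OF lin] linearD_scale[OF lin]
        scale_right_distrib sum.distrib scale_sum_right mult.commute)
qed

text \<open>The proviso \<open>2 \<le> m + n - 1\<close> of the last case can be dropped: for \<open>m = n = 1\<close> both summands
  are evaluated at \<open>[2]\<close> and vanish.\<close>

lemma OA_comp_append:
  assumes f: "f \<in> OA scale m" and g: "g \<in> OA scale n"
    and "1 \<le> n" "1 \<le> i" "i \<le> m" "length xs = i - 1" "length ys = n" "length zs = m - i"
  shows "OA_comp scale m n i f g (basis_vec r) (xs @ ys @ zs) =
    (if r = 0 then 0
     else if r < i then f (basis_vec r) (xs @ g (Sigma_vec n) ys # zs)
     else if r < i + n then f (basis_vec i) (xs @ g (basis_vec (r + 1 - i)) ys # zs)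
     else if r < m + n then f (basis_vec (r + 1 - n)) (xs @ g (Sigma_vec n) ys # zs)
     else if r = m + n then f (basis_vec i) (xs @ g (basis_vec (n + 1)) ys # zs)
       + f (basis_vec (m + 1)) (xs @ g (Sigma_vec n) ys # zs)
     else 0)"
proof -
  have len: "length (xs @ ys @ zs) = m + n - 1" using assms by simp
  have slices: "take (i - 1) (xs @ ys @ zs) = xs" "take n (drop (i - 1) (xs @ ys @ zs)) = ys"
    "drop (i - 1 + n) (xs @ ys @ zs) = zs"
    using assms by simp_all
  have arity_one: "g (basis_vec (n + 1)) ys = 0" "f (basis_vec (m + 1)) bs = 0"
    if "\<not> 2 \<le> m + n - 1" for bs
    using that assms OA_not_C[OF f] OA_not_C[OF g] by (simp_all add: C_def)
  have bounds: "r \<le> i - 1 \<longleftrightarrow> r < i" "r \<le> i + n - 1 \<longleftrightarrow> r < i + n"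
    "r \<le> m + n - 1 \<longleftrightarrow> r < m + n"
    using assms by auto
  have eq: "OA_comp scale m n i f g (basis_vec r) (xs @ ys @ zs) =
    (if 1 \<le> r \<and> r < i then f (basis_vec r) (xs @ g (Sigma_vec n) ys # zs)
     else if i \<le> r \<and> r < i + n then f (basis_vec i) (xs @ g (basis_vec (r - i + 1)) ys # zs)
     else if i + n \<le> r \<and> r < m + n then f (basis_vec (r - n + 1)) (xs @ g (Sigma_vec n) ys # zs)
     else if r = m + n \<and> 2 \<le> m + n - 1 then f (basis_vec i) (xs @ g (basis_vec (n + 1)) ys # zs)
       + f (basis_vec (m + 1)) (xs @ g (Sigma_vec n) ys # zs)
     else 0)"
    by (simp only: OA_comp_basis_vec[OF vector_space_axioms len] comp_basis_def Let_def slices bounds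
        append_Cons append_Nil)
  consider "r = 0" | "1 \<le> r" "r < i" | "i \<le> r" "r < i + n" | "i + n \<le> r" "r < m + n"
    | "r = m + n" | "m + n < r"
    by linarith
  then show ?thesis
  proof cases
    case 1
    with assms show ?thesis
      unfolding eq by simp
  next
    case 5
    then have "\<not> r = 0" "\<not> r < i" "\<not> r < i + n" "\<not> r < m + n"
      using assms by auto
    moreover have "f (basis_vec i) (xs @ g (basis_vec (n + 1)) ys # zs)
        + f (basis_vec (m + 1)) (xs @ g (Sigma_vec n) ys # zs) = 0" if "\<not> 2 \<le> m + n - 1"
      by (simp only: arity_one[OF that] linearD_zero[OF OA_linear_entry[OF f]] add_0_left)
    ultimately show ?thesis
      using 5 unfolding eq by simp
  qed (use assms in \<open>simp_all add: eq Suc_diff_le\<close>)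
qed

text \<open>The branches of \<open>comp_basis\<close> cover exactly the indices in
  \<open>C (m + n - 1)\<close>; the proviso in the last one excludes \<open>[2]\<close> in arity
  one.\<close>

lemma OA_comp_closed:
  assumes f: "f \<in> OA scale m" and g: "g \<in> OA scale n"
    and "1 \<le> n" "1 \<le> i" "i \<le> m"
  shows "OA_comp scale m n i f g \<in> OA scale (m + n - 1)"
proof -
  have "OA_comp scale m n i f g (basis_vec r) as = 0" if r: "r \<notin> C (m + n - 1)" for r as
  proof (cases "length as = m + n - 1")
    case True
    have "comp_basis m n i f g r as = 0"
      using r assms by (auto simp: comp_basis_def Let_def C_iff)
    then show ?thesis
      by (simp add: OA_comp_basis_vec[OF vector_space_axioms True])
  qed (rule OA_comp_length)
  then show ?thesis
    using OA_comp_linear_update[OF assms(1,2,4,5)]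
    unfolding OA_def[of scale "m + n - 1"] mem_Collect_eq
    by (simp add: OA_comp_length OA_comp_linear_vec)
qed

text \<open>The case \<open>r = m + n\<close> of the composition is what makes this identity hold.\<close>

lemma OA_comp_Sigma:
  assumes f: "f \<in> OA scale m" and g: "g \<in> OA scale n"
    and "1 \<le> n" "1 \<le> i" "i \<le> m" "length xs = i - 1" "length ys = n" "length zs = m - i"
  shows "OA_comp scale m n i f g (Sigma_vec (m + n - 1)) (xs @ ys @ zs)
    = f (Sigma_vec m) (xs @ g (Sigma_vec n) ys # zs)"
proof -
  let ?h = "\<lambda>r. OA_comp scale m n i f g (basis_vec r) (xs @ ys @ zs)"
  let ?f = "\<lambda>r. f (basis_vec r) (xs @ g (Sigma_vec n) ys # zs)"
  note app = OA_comp_append[OF assms]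
  \<comment> \<open>The indices in the block of \<open>g\<close> supply \<open>g\<close> at
    \<open>[1]\<close>, ..., \<open>[n]\<close>. The missing \<open>[n + 1]\<close> comes from the
    first summand of the case \<open>r = m + n\<close>, and linearity of \<open>f\<close> in slot
    \<open>i\<close> collects everything into \<Sigma>.\<close>
  have block: "(\<Sum>r = i..<i + n. ?h r) + f (basis_vec i) (xs @ g (basis_vec (n + 1)) ys # zs) = ?f i"
  proof -
    have "(\<Sum>r = i..<i + n. ?h r)
        = (\<Sum>r = i..<i + n. f (basis_vec i) (xs @ g (basis_vec (r + 1 - i)) ys # zs))"
      using assms by (intro sum.cong) (auto simp: app)
    also have "\<dots> = (\<Sum>r = 1..<1 + n. f (basis_vec i) (xs @ g (basis_vec r) ys # zs))"
      by (rule sum.reindex_bij_witness[of _ "\<lambda>r. r + i - 1" "\<lambda>r. r + 1 - i"]) auto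
    finally have "(\<Sum>r = i..<i + n. ?h r) + f (basis_vec i) (xs @ g (basis_vec (n + 1)) ys # zs)
        = (\<Sum>r = 1..n + 1. f (basis_vec i) (xs @ g (basis_vec r) ys # zs))"
      by (simp add: atLeastLessThanSuc_atLeastAtMost)
    then show ?thesis
      by (simp only: OA_Sigma[OF g] linearD_sum[OF OA_linear_entry[OF f]])
  qed
  have right: "(\<Sum>r = i + n..<m + n. ?h r) = (\<Sum>r = i + 1..<m + 1. ?f r)"
  proof -
    have "(\<Sum>r = i + n..<m + n. ?h r) = (\<Sum>r = i + n..<m + n. ?f (r + 1 - n))"
      using assms by (intro sum.cong) (auto simp: app)
    also have "\<dots> = (\<Sum>r = i + 1..<m + 1. ?f r)"
      by (rule sum.reindex_bij_witness[of _ "\<lambda>r. r + n - 1" "\<lambda>r. r + 1 - n"]) (use assms in auto)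
    finally show ?thesis .
  qed
  have "OA_comp scale m n i f g (Sigma_vec (m + n - 1)) (xs @ ys @ zs)
      = (\<Sum>r = 1..<m + n + 1. ?h r)"
    using OA_Sigma[OF OA_comp_closed[OF f g]] assms by (simp add: atLeastLessThanSuc_atLeastAtMost)
  also have "\<dots> = (\<Sum>r = 1..<i. ?h r) + (\<Sum>r = i..<i + n. ?h r)
      + (\<Sum>r = i + n..<m + n. ?h r) + ?h (m + n)"
    using assms by (simp add: sum.atLeastLessThan_concat)
  also have "(\<Sum>r = 1..<i. ?h r) = (\<Sum>r = 1..<i. ?f r)"
    by (intro sum.cong) (auto simp: app)
  \<comment> \<open>The two summands go to different places: the first completes the block at
    \<open>i\<close>, the second is the last term of \<open>f\<close> at \<Sigma>.\<close>
  also have "?h (m + n) = f (basis_vec i) (xs @ g (basis_vec (n + 1)) ys # zs) + ?f (m + 1)"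
    using assms by (simp add: app)
  also have "(\<Sum>r = 1..<i. ?f r) + (\<Sum>r = i..<i + n. ?h r) + (\<Sum>r = i + n..<m + n. ?h r)
      + (f (basis_vec i) (xs @ g (basis_vec (n + 1)) ys # zs) + ?f (m + 1))
    = (\<Sum>r = 1..<i. ?f r) + ?f i + (\<Sum>r = i + 1..<m + 1. ?f r) + ?f (m + 1)"
    unfolding right block[symmetric] by (simp only: ac_simps)
  also have "\<dots> = (\<Sum>r = 1..<m + 2. ?f r)"
  proof -
    have "(\<Sum>r = 1..<i. ?f r) + ?f i = (\<Sum>r = 1..<i + 1. ?f r)"
      using assms by simp
    moreover have "(\<Sum>r = 1..<i + 1. ?f r) + (\<Sum>r = i + 1..<m + 1. ?f r) = (\<Sum>r = 1..<m + 1. ?f r)"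
      using assms by (intro sum.atLeastLessThan_concat) auto
    moreover have "(\<Sum>r = 1..<m + 1. ?f r) + ?f (m + 1) = (\<Sum>r = 1..<m + 2. ?f r)"
      by simp
    ultimately show ?thesis by (simp only:)
  qed
  also have "\<dots> = f (Sigma_vec m) (xs @ g (Sigma_vec n) ys # zs)"
    by (simp add: OA_Sigma[OF f] atLeastLessThanSuc_atLeastAtMost del: sum.op_ivl_Suc)
  finally show ?thesis .
qed

section \<open>The two associativity axioms\<close>

text \<open>If \<open>[r]\<close> points outside the block of \<open>g\<close>, both sides contain
  \<open>g(\<Sigma>; h(\<Sigma>))\<close>, on the right by \<open>OA_comp_Sigma\<close>. At the last
  index both sides are the sum of \<open>f([i]; g([j]; h([p+1])))\<close>,
  \<open>f([i]; g([n+1]; h(\<Sigma>)))\<close> and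
  \<open>f([m+1]; g(\<Sigma>; h(\<Sigma>)))\<close>; on the right this uses additivity of
  \<open>f\<close> in slot \<open>i\<close>.\<close>

lemma OA_comp_seq:
  assumes f: "f \<in> OA scale m" and g: "g \<in> OA scale n" and h: "h \<in> OA scale p"
    and ij: "1 \<le> i" "i \<le> m" "1 \<le> j" "j \<le> n" and p: "1 \<le> p"
  shows "OA_comp scale (m + n - 1) p (i + j - 1) (OA_comp scale m n i f g) h
    = OA_comp scale m (n + p - 1) i f (OA_comp scale n p j g h)"
    (is "?L = ?R")
proof (rule OA_eqI)
  have fg: "OA_comp scale m n i f g \<in> OA scale (m + n - 1)"
    using ij by (intro OA_comp_closed[OF f g]) auto
  have gh: "OA_comp scale n p j g h \<in> OA scale (n + p - 1)"
    using ij p by (intro OA_comp_closed[OF g h]) auto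
  have idx: "m + (n + p - 1) - 1 = m + n - 1 + p - 1"
    using ij p by simp
  show "?L \<in> OA scale (m + n - 1 + p - 1)"
    using ij p by (intro OA_comp_closed[OF fg h]) auto
  show "?R \<in> OA scale (m + n - 1 + p - 1)"
    unfolding idx[symmetric] using ij p by (intro OA_comp_closed[OF f gh]) auto
  show "1 \<le> m + n - 1 + p - 1"
    using ij p by simp
  fix r and as :: "'a list"
  assume r: "1 \<le> r" "r \<le> m + n - 1 + p - 1 + 1" and len: "length as = m + n - 1 + p - 1"
  have "length as = (i - 1) + (j - 1 + p + (n - j)) + (m - i)"
    using len ij by simp
  then obtain xs bs vs where as1: "as = xs @ bs @ vs" and len1: "length xs = i - 1"
      "length bs = j - 1 + p + (n - j)" "length vs = m - i"
    by (rule split_append3)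
  from len1(2) obtain ys zs us where bs: "bs = ys @ zs @ us" and len2: "length ys = j - 1"
      "length zs = p" "length us = n - j"
    by (rule split_append3)
  have as: "as = xs @ ys @ zs @ us @ vs"
    by (simp add: as1 bs)
  have k: "1 \<le> n" "1 \<le> n + p - 1" "1 \<le> i + j - 1" "i + j - 1 \<le> m + n - 1"
    and lens: "length (xs @ ys) = i + j - 1 - 1" "length (us @ vs) = m + n - 1 - (i + j - 1)"
      "length (ys @ y # us) = n" "length (ys @ zs @ us) = n + p - 1" for y
    using ij p len1 len2 by auto
  \<comment> \<open>\<open>L1\<close> and \<open>R1\<close> open the outer compositions,
    \<open>L2\<close> and \<open>R2\<close> the inner ones, and \<open>R3\<close> the inner one at
    \<Sigma>. The entry \<open>y\<close> in \<open>L2\<close> stands for the value of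
    \<open>h\<close>.\<close>
  note L1 = OA_comp_append[OF fg h p k(3,4) lens(1) len2(2) lens(2), unfolded append_assoc]
  note L2 = OA_comp_append[OF f g k(1) ij(1,2) len1(1) lens(3) len1(3),
      unfolded append_assoc append_Cons]
  note R1 = OA_comp_append[OF f gh k(2) ij(1,2) len1(1) lens(4) len1(3), unfolded append_assoc]
  note R2 = OA_comp_append[OF g h p ij(3,4) len2]
  note R3 = OA_comp_Sigma[OF g h p ij(3,4) len2]
  \<comment> \<open>Writing the indices as successors of sums removes truncated subtraction, so
    simplification can decide the range of \<open>r\<close>.\<close>
  obtain a b c d where abcd: "i = Suc a" "m = Suc (a + b)" "j = Suc c" "n = Suc (c + d)"
    by (rule that[of "i - 1" "m - i" "j - 1" "n - j"]) (use ij in auto)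
  \<comment> \<open>The ranges follow the blocks \<open>xs\<close>, \<open>ys\<close>,
    \<open>zs\<close>, \<open>us\<close>, \<open>vs\<close>, with the extra index
    \<open>m + n + p - 1\<close> last; \<open>q\<close> is the offset within a block.\<close>
  consider "r < i" | q where "r = i + q" "q < c" | q where "r = i + c + q" "q < p"
    | q where "r = i + c + p + q" "q < d" | q where "r = i + c + p + d + q" "q < b"
    | "r = i + c + p + d + b"
  proof -
    have "r \<le> i + c + p + d + b" using r p unfolding abcd by simp
    then consider "r < i" | "i \<le> r" "r < i + c" | "i + c \<le> r" "r < i + c + p"
      | "i + c + p \<le> r" "r < i + c + p + d" | "i + c + p + d \<le> r" "r < i + c + p + d + b"
      | "r = i + c + p + d + b"
      by linarith
    then show ?thesis
      using that(1,6) that(2)[of "r - i"] that(3)[of "r - (i + c)"] that(4)[of "r - (i + c + p)"]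
        that(5)[of "r - (i + c + p + d)"]
      by cases simp_all
  qed
  then show "?L (basis_vec r) as = ?R (basis_vec r) as"
    unfolding as L1 R1 R3
    by cases (use p r in \<open>simp_all add: L2[unfolded abcd] R2[unfolded abcd] abcd
        linearD_add[OF OA_linear_entry[OF f]]\<close>)
qed

text \<open>The operations \<open>g\<close> and \<open>h\<close> fill different slots of
  \<open>f\<close>, and in each range before the last at most one of them receives a basis vector,
  the other \<Sigma>. At the last index the same three terms appear on both sides in different
  order.\<close>

lemma OA_comp_par:
  assumes f: "f \<in> OA scale m" and g: "g \<in> OA scale n" and h: "h \<in> OA scale p"
    and n: "1 \<le> n" and p: "1 \<le> p" and ij: "1 \<le> i" "i < j" "j \<le> m"
  shows "OA_comp scale (m + n - 1) p (j + n - 1) (OA_comp scale m n i f g) h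
    = OA_comp scale (m + p - 1) n i (OA_comp scale m p j f h) g"
    (is "?L = ?R")
proof (rule OA_eqI)
  have fg: "OA_comp scale m n i f g \<in> OA scale (m + n - 1)"
    using ij n by (intro OA_comp_closed[OF f g]) auto
  have fh: "OA_comp scale m p j f h \<in> OA scale (m + p - 1)"
    using ij p by (intro OA_comp_closed[OF f h]) auto
  have idx: "m + p - 1 + n - 1 = m + n - 1 + p - 1"
    using n p by simp
  show "?L \<in> OA scale (m + n - 1 + p - 1)"
    using ij n p by (intro OA_comp_closed[OF fg h]) auto
  show "?R \<in> OA scale (m + n - 1 + p - 1)"
    unfolding idx[symmetric] using ij n p by (intro OA_comp_closed[OF fh g]) auto
  show "1 \<le> m + n - 1 + p - 1"
    using ij n p by simp
  fix r :: nat and as :: "'a list"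
  assume r: "1 \<le> r" "r \<le> m + n - 1 + p - 1 + 1" and len: "length as = m + n - 1 + p - 1"
  have "length as = (i - 1) + n + ((j - i - 1) + p + (m - j))"
    using len ij n p by simp
  then obtain xs ys bs where as1: "as = xs @ ys @ bs" and len1: "length xs = i - 1"
      "length ys = n" "length bs = (j - i - 1) + p + (m - j)"
    by (rule split_append3)
  from len1(3) obtain zs us vs where bs: "bs = zs @ us @ vs" and len2: "length zs = j - i - 1"
      "length us = p" "length vs = m - j"
    by (rule split_append3)
  have as: "as = xs @ ys @ zs @ us @ vs"
    by (simp add: as1 bs)
  have k: "i \<le> m" "1 \<le> j" "1 \<le> j + n - 1" "j + n - 1 \<le> m + n - 1" "i \<le> m + p - 1"
    and lens: "length (xs @ ys @ zs) = j + n - 1 - 1" "length vs = m + n - 1 - (j + n - 1)"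
      "length (zs @ y # vs) = m - i" "length (zs @ us @ vs) = m + p - 1 - i"
      "length (xs @ y # zs) = j - 1" for y
    using ij n p len1 len2 by auto
  note L1 = OA_comp_append[OF fg h p k(3,4) lens(1) len2(2) lens(2), unfolded append_assoc]
  note L2 = OA_comp_append[OF f g n ij(1) k(1) len1(1,2) lens(3)]
  note R1 = OA_comp_append[OF fh g n ij(1) k(5) len1(1,2) lens(4)]
  note R2 = OA_comp_append[OF f h p k(2) ij(3) lens(5) len2(2,3), unfolded append_assoc append_Cons]
  obtain a b c where abc: "i = Suc a" "j = Suc (Suc (a + b))" "m = Suc (Suc (a + (b + c)))"
    by (rule that[of "i - 1" "j - i - 1" "m - j"]) (use ij in auto)
  consider "r < i" | q where "r = i + q" "q < n" | q where "r = i + n + q" "q < b"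
    | q where "r = i + n + b + q" "q < p" | q where "r = i + n + b + p + q" "q < c"
    | "r = i + n + b + p + c"
  proof -
    have "r \<le> i + n + b + p + c" using r n p unfolding abc by simp
    then consider "r < i" | "i \<le> r" "r < i + n" | "i + n \<le> r" "r < i + n + b"
      | "i + n + b \<le> r" "r < i + n + b + p" | "i + n + b + p \<le> r" "r < i + n + b + p + c"
      | "r = i + n + b + p + c"
      by linarith
    then show ?thesis
      using that(1,6) that(2)[of "r - i"] that(3)[of "r - (i + n)"] that(4)[of "r - (i + n + b)"]
        that(5)[of "r - (i + n + b + p)"]
      by cases simp_all
  qed
  then show "?L (basis_vec r) as = ?R (basis_vec r) as"
    unfolding as L1 R1
    by cases (use n p r in \<open>simp_all add: L2[unfolded abc] R2[unfolded abc] abc add.assoc\<close>)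
qed

section \<open>The identity element\<close>

lemma OA_id_closed: "OA_id scale \<in> OA scale 1"
proof -
  have "OA_id scale (basis_vec r) as = 0" if "r \<notin> C 1" for r and as :: "'a list"
    using that by (simp add: OA_id_def lookup_basis_vec C_def)
  moreover have "hd (as[j := x]) = x" if "length as = 1" "j < 1" for as :: "'a list" and j x
    using that by (cases as) auto
  ultimately show ?thesis
    by (auto simp: OA_def linear_free_iff linear_self_iff OA_id_def lookup_add lookup_free_scale
        scale_left_distrib scale_right_distrib scale_left_commute)
qed

lemma OA_id_basis_vec_eq: "OA_id scale (basis_vec r) [y] = (if r = 1 then y else 0)"
  by (simp add: OA_id_def lookup_basis_vec)

text \<open>\<open>Sigma_vec 1\<close> is \<open>[1] + [2]\<close>, and the identity vanishes at
  \<open>[2]\<close>.\<close>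

lemma OA_id_Sigma: "OA_id scale (Sigma_vec 1) [y] = y"
  using OA_Sigma[OF OA_id_closed, of "[y]"] by (simp add: OA_id_basis_vec_eq)

text \<open>At \<open>[1]\<close> and at \<Sigma> the identity returns its entry. For
  \<open>r = m + 1\<close> the first summand inserts \<open>id([2]; y) = 0\<close> into
  \<open>f\<close> and vanishes.\<close>

lemma OA_comp_id_right:
  assumes f: "f \<in> OA scale m" and i: "1 \<le> i" "i \<le> m"
  shows "OA_comp scale m 1 i f (OA_id scale) = f"
proof (rule OA_eqI)
  show "OA_comp scale m 1 i f (OA_id scale) \<in> OA scale m"
    using OA_comp_closed[OF f OA_id_closed _ i] by simp
  fix r :: nat and as :: "'a list"
  assume r: "1 \<le> r" "r \<le> m + 1" and "length as = m"
  then have "length as = (i - 1) + 1 + (m - i)" using i by simp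
  then obtain xs ys zs where as: "as = xs @ ys @ zs"
    and len: "length xs = i - 1" "length ys = 1" "length zs = m - i"
    by (rule split_append3)
  obtain y where ys: "ys = [y]" using len(2) by (auto simp: length_Suc_conv)
  show "OA_comp scale m 1 i f (OA_id scale) (basis_vec r) as = f (basis_vec r) as"
    unfolding as OA_comp_append[OF f OA_id_closed order_refl i len]
    using r i by (cases "r = i") (auto simp: ys OA_id_basis_vec_eq OA_id_Sigma[simplified]
        linearD_zero[OF OA_linear_entry[OF f]])
qed (use f i in auto)

lemma OA_comp_id_left:
  assumes f: "f \<in> OA scale m" and m: "1 \<le> m"
  shows "OA_comp scale 1 m 1 (OA_id scale) f = f"
proof (rule OA_eqI)
  show "OA_comp scale 1 m 1 (OA_id scale) f \<in> OA scale m"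
    using OA_comp_closed[OF OA_id_closed f m, of 1] by simp
  fix r :: nat and as :: "'a list"
  assume r: "1 \<le> r" "r \<le> m + 1" and len: "length as = m"
  \<comment> \<open>The empty outer blocks bring the list into the form of
    \<open>OA_comp_append\<close>. For \<open>r = m + 1\<close> the second summand is the identity
    at \<open>[2]\<close>, which is zero.\<close>
  have "OA_comp scale 1 m 1 (OA_id scale) f (basis_vec r) ([] @ as @ []) = f (basis_vec r) as"
    using r by (subst OA_comp_append[OF OA_id_closed f m])
      (auto simp: len OA_id_basis_vec_eq OA_id_basis_vec_eq[simplified])
  then show "OA_comp scale 1 m 1 (OA_id scale) f (basis_vec r) as = f (basis_vec r) as"
    by simp
qed (use f m in auto)

section \<open>Vector space structure and bilinearity of composition\<close>

lemma OA_scale_apply: "OA_scale scale c f s as = c *s f s as"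
  by (simp add: OA_scale_def)

lemma OA_add: "f \<in> OA scale n \<Longrightarrow> f' \<in> OA scale n \<Longrightarrow> f + f' \<in> OA scale n"
  by (simp add: OA_def linear_free_iff linear_self_iff scale_right_distrib ac_simps)

lemma OA_scale_closed: "f \<in> OA scale n \<Longrightarrow> OA_scale scale c f \<in> OA scale n"
  by (simp add: OA_def OA_scale_def linear_free_iff linear_self_iff scale_right_distrib
      mult.commute)

lemma vector_space_OA_scale: "vector_space (OA_scale scale)"
  by unfold_locales
    (auto simp: OA_scale_def fun_eq_iff scale_right_distrib scale_left_distrib)

lemma subspace_OA: "module.subspace (OA_scale scale) (OA scale n)"
proof -
  interpret S: vector_space "OA_scale scale" by (rule vector_space_OA_scale)
  have "0 \<in> OA scale n"
    by (simp add: OA_def linear_free_iff linear_self_iff)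
  then show ?thesis
    by (simp add: S.subspace_def OA_add OA_scale_closed)
qed

text \<open>Presents the arguments already split at the insertion point, so that
  \<open>OA_comp_append\<close> applies directly.\<close>

lemma OA_comp_eqI:
  assumes "1 \<le> n" "1 \<le> i" "i \<le> m" "F \<in> OA scale (m + n - 1)" "G \<in> OA scale (m + n - 1)"
    and eq: "\<And>(r::nat) xs ys zs. 1 \<le> r \<Longrightarrow> length xs = i - 1 \<Longrightarrow> length ys = n \<Longrightarrow> length zs = m - i \<Longrightarrow>
      F (basis_vec r) (xs @ ys @ zs) = G (basis_vec r) (xs @ ys @ zs)"
  shows "F = G"
proof (rule OA_eqI[OF assms(4,5)])
  fix r :: nat and as :: "'a list"
  assume r: "1 \<le> r" and "length as = m + n - 1"
  then have "length as = (i - 1) + n + (m - i)" using assms by simp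
  then obtain xs ys zs where "as = xs @ ys @ zs" "length xs = i - 1" "length ys = n"
      "length zs = m - i"
    by (rule split_append3)
  with eq r show "F (basis_vec r) as = G (basis_vec r) as" by simp
qed (use assms in simp)

lemma OA_comp_bilinear:
  assumes f: "f \<in> OA scale m" and g: "g \<in> OA scale n" and i: "1 \<le> n" "1 \<le> i" "i \<le> m"
  shows OA_comp_add_left: "f' \<in> OA scale m \<Longrightarrow>
      OA_comp scale m n i (f + f') g = OA_comp scale m n i f g + OA_comp scale m n i f' g"
    and OA_comp_add_right: "g' \<in> OA scale n \<Longrightarrow>
      OA_comp scale m n i f (g + g') = OA_comp scale m n i f g + OA_comp scale m n i f g'"
    and OA_comp_scale_left:
      "OA_comp scale m n i (OA_scale scale c f) g = OA_scale scale c (OA_comp scale m n i f g)"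
    and OA_comp_scale_right:
      "OA_comp scale m n i f (OA_scale scale c g) = OA_scale scale c (OA_comp scale m n i f g)"
proof -
  show "OA_comp scale m n i (f + f') g = OA_comp scale m n i f g + OA_comp scale m n i f' g"
    if f': "f' \<in> OA scale m"
    by (rule OA_comp_eqI[OF i], (intro OA_comp_closed OA_add OA_scale_closed f g i f')+)
      (simp add: f g f' OA_add OA_scale_closed OA_comp_append[OF _ _ i])
  show "OA_comp scale m n i f (g + g') = OA_comp scale m n i f g + OA_comp scale m n i f g'"
    if g': "g' \<in> OA scale n"
    by (rule OA_comp_eqI[OF i], (intro OA_comp_closed OA_add OA_scale_closed f g i g')+)
      (simp add: f g g' OA_add OA_scale_closed OA_comp_append[OF _ _ i] linearD_add[OF OA_linear_entry[OF f]])
  show "OA_comp scale m n i (OA_scale scale c f) g = OA_scale scale c (OA_comp scale m n i f g)"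
    by (rule OA_comp_eqI[OF i], (intro OA_comp_closed OA_add OA_scale_closed f g i)+)
      (simp add: f g OA_add OA_scale_closed OA_comp_append[OF _ _ i] OA_scale_apply scale_right_distrib)
  show "OA_comp scale m n i f (OA_scale scale c g) = OA_scale scale c (OA_comp scale m n i f g)"
    by (rule OA_comp_eqI[OF i], (intro OA_comp_closed OA_add OA_scale_closed f g i)+)
      (simp add: f g OA_add OA_scale_closed OA_comp_append[OF _ _ i] OA_scale_apply scale_right_distrib
        linearD_scale[OF OA_linear_entry[OF f]])
qed

lemma ns_operad_OA: "ns_operad (OA_scale scale) (OA scale) (OA_comp scale) (OA_id scale)"
proof -
  interpret S: vector_space "OA_scale scale" by (rule vector_space_OA_scale)
  show ?thesis
    by unfold_locales
      (blast intro: subspace_OA OA_comp_closed OA_comp_add_left OA_comp_add_right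
        OA_comp_scale_left OA_comp_scale_right OA_comp_seq OA_comp_par OA_id_closed
        OA_comp_id_right OA_comp_id_left)+
qed

section \<open>Multiplications and NS-algebras\<close>

text \<open>Inverse of the correspondence: weighting the operations by the coordinates of
  \<open>s\<close> at \<open>1\<close>, \<open>2\<close>, \<open>3\<close> gives linearity in
  \<open>s\<close> and the value zero at basis vectors outside \<open>C 2\<close>.\<close>

definition cochain_of_ops ::
  "('a \<Rightarrow> 'a \<Rightarrow> 'a) \<Rightarrow> ('a \<Rightarrow> 'a \<Rightarrow> 'a) \<Rightarrow> ('a \<Rightarrow> 'a \<Rightarrow> 'a) \<Rightarrow> ('k, 'a) cochain" where
  "cochain_of_ops l r v = (\<lambda>s as. if length as = 2
     then Poly_Mapping.lookup s 1 *s l (as ! 0) (as ! 1) + Poly_Mapping.lookup s 2 *s r (as ! 0) (as ! 1)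
       + Poly_Mapping.lookup s 3 *s v (as ! 0) (as ! 1)
     else 0)"

lemma cochain_of_ops_basis_vec:
  "cochain_of_ops l r v (basis_vec 1) [a, b] = l a b"
  "cochain_of_ops l r v (basis_vec 2) [a, b] = r a b"
  "cochain_of_ops l r v (basis_vec 3) [a, b] = v a b"
  by (simp_all add: cochain_of_ops_def lookup_basis_vec)

lemma cochain_of_ops_closed:
  assumes "bilinear_op scale l" "bilinear_op scale r" "bilinear_op scale v"
  shows "cochain_of_ops l r v \<in> OA scale 2"
proof -
  have "cochain_of_ops l r v (basis_vec k) as = 0" if "k \<notin> C 2" for k and as :: "'a list"
    using that by (auto simp: cochain_of_ops_def lookup_basis_vec C_def when_def)
  moreover have "Vector_Spaces.linear free_scale scale (\<lambda>s. cochain_of_ops l r v s as)" for as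
    by (simp add: cochain_of_ops_def linear_free_iff lookup_add lookup_free_scale
        scale_left_distrib scale_right_distrib ac_simps)
  moreover have "Vector_Spaces.linear scale scale (\<lambda>x. cochain_of_ops l r v s (as[j := x]))"
    if "length as = 2" "j < 2" for s j and as :: "'a list"
  proof -
    have "j = 0 \<or> j = 1" using that by auto
    with assms that show ?thesis
      by (auto simp: cochain_of_ops_def bilinear_op_def linear_self_iff scale_right_distrib
          mult.commute ac_simps)
  qed
  moreover have "cochain_of_ops l r v s as = 0" if "length as \<noteq> 2" for s and as :: "'a list"
    using that by (simp add: cochain_of_ops_def)
  ultimately show ?thesis
    unfolding OA_def by blast
qed

lemma OA_2_Sigma:
  assumes "p \<in> OA scale 2"
  shows "p (Sigma_vec 2) as = p (basis_vec 1) as + p (basis_vec 2) as + p (basis_vec 3) as"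
proof -
  have "{1..2 + 1} = {1, 2, 3 :: nat}" by auto
  then show ?thesis by (simp add: OA_Sigma[OF assms] add.assoc)
qed

lemma OA_2_bilinear:
  assumes "p \<in> OA scale 2"
  shows "bilinear_op scale (\<lambda>a b. p s [a, b])"
  using OA_linear_entry[OF assms, of s "[]"] OA_linear_entry[OF assms, of s "[_]" "[]"]
  by (simp add: bilinear_op_def)

lemma length_3_conv: "length as = 3 \<longleftrightarrow> (\<exists>a b c. as = [a, b, c])"
  by (auto simp: numeral_eq_Suc length_Suc_conv)

text \<open>Bilinearity of the three operations is automatic for a cochain, and \<open>p\<close> at
  \<Sigma> is the total product, so only the four identities have to be matched.\<close>

lemma multiplication_iff_ns_algebra:
  assumes p: "p \<in> OA scale 2"
  shows "OA_comp scale 2 2 1 p p = OA_comp scale 2 2 2 p p \<longleftrightarrow>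
    ns_algebra scale (\<lambda>a b. p (basis_vec 1) [a, b]) (\<lambda>a b. p (basis_vec 2) [a, b])
      (\<lambda>a b. p (basis_vec 3) [a, b])"
    (is "?L = ?R \<longleftrightarrow> ?NS")
proof -
  have L: "?L (basis_vec r) [a, b, c] =
    (if r = 1 then p (basis_vec 1) [p (basis_vec 1) [a, b], c]
     else if r = 2 then p (basis_vec 1) [p (basis_vec 2) [a, b], c]
     else if r = 3 then p (basis_vec 2) [p (Sigma_vec 2) [a, b], c]
     else if r = 4 then p (basis_vec 1) [p (basis_vec 3) [a, b], c]
       + p (basis_vec 3) [p (Sigma_vec 2) [a, b], c]
     else 0)" for r a b c
  proof -
    consider "r = 0" | "r = 1" | "r = 2" | "r = 3" | "r = 4" | "4 < r" by linarith
    then show ?thesis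
      using OA_comp_append[OF p p, of 1 "[]" "[a, b]" "[c]" r] by cases simp_all
  qed
  have R: "?R (basis_vec r) [a, b, c] =
    (if r = 1 then p (basis_vec 1) [a, p (Sigma_vec 2) [b, c]]
     else if r = 2 then p (basis_vec 2) [a, p (basis_vec 1) [b, c]]
     else if r = 3 then p (basis_vec 2) [a, p (basis_vec 2) [b, c]]
     else if r = 4 then p (basis_vec 2) [a, p (basis_vec 3) [b, c]]
       + p (basis_vec 3) [a, p (Sigma_vec 2) [b, c]]
     else 0)" for r a b c
  proof -
    consider "r = 0" | "r = 1" | "r = 2" | "r = 3" | "r = 4" | "4 < r" by linarith
    then show ?thesis
      using OA_comp_append[OF p p, of 2 "[a]" "[b, c]" "[]" r] by cases simp_all
  qed
  have closed: "?L \<in> OA scale 3" "?R \<in> OA scale 3"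
    using OA_comp_closed[OF p p, of 1] OA_comp_closed[OF p p, of 2] by simp_all
  \<comment> \<open>Both composites have arity three and \<open>C 3\<close> is
    \<open>{1..4}\<close>, so four basis vectors decide equality.\<close>
  have "?L = ?R \<longleftrightarrow> (\<forall>a b c. \<forall>r\<in>{1, 2, 3, 4}. ?L (basis_vec r) [a, b, c] = ?R (basis_vec r) [a, b, c])"
  proof
    assume *: "\<forall>a b c. \<forall>r\<in>{1, 2, 3, 4}. ?L (basis_vec r) [a, b, c] = ?R (basis_vec r) [a, b, c]"
    show "?L = ?R"
    proof (rule OA_eqI[OF closed])
      fix r :: nat and as :: "'a list"
      assume "1 \<le> r" "r \<le> 3 + 1" "length as = 3"
      moreover from this have "r \<in> {1, 2, 3, 4}" by auto
      ultimately show "?L (basis_vec r) as = ?R (basis_vec r) as"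
        using * by (auto simp only: length_3_conv)
    qed simp
  qed simp
  also have "\<dots> \<longleftrightarrow> ?NS"
    using OA_2_bilinear[OF p] vector_space_axioms
    by (auto simp: L R OA_2_Sigma[OF p] ns_algebra_def ns_algebra_axioms_def
        simp del: One_nat_def)
  finally show ?thesis .
qed

text \<open>Injective because the three operations are the values at all of \<open>C 2\<close>;
  surjective through \<open>cochain_of_ops\<close>.\<close>

lemma bij_betw_multiplications_ns_algebras:
  "bij_betw
    (\<lambda>p. (\<lambda>a b. p (basis_vec 1) [a, b],
          \<lambda>a b. p (basis_vec 2) [a, b],
          \<lambda>a b. p (basis_vec 3) [a, b]))
    {p \<in> OA scale 2. OA_comp scale 2 2 1 p p = OA_comp scale 2 2 2 p p}
    {(l, r, v). ns_algebra scale l r v}"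
    (is "bij_betw ?ops ?M ?N")
  unfolding bij_betw_def
proof
  show "inj_on ?ops ?M"
  proof (rule inj_onI)
    fix p q
    assume p: "p \<in> ?M" and q: "q \<in> ?M" and eq: "?ops p = ?ops q"
    show "p = q"
    proof (rule OA_eqI[of _ 2])
      fix r :: nat and as :: "'a list"
      assume "1 \<le> r" "r \<le> 2 + 1" "length as = 2"
      then have "r = 1 \<or> r = 2 \<or> r = 3" and "\<exists>a b. as = [a, b]"
        by (auto simp: numeral_eq_Suc length_Suc_conv)
      with eq show "p (basis_vec r) as = q (basis_vec r) as"
        by (auto simp: fun_eq_iff)
    qed (use p q in auto)
  qed
  show "?ops ` ?M = ?N"
  proof (intro equalityI subsetI)
    fix x
    assume "x \<in> ?ops ` ?M"
    then show "x \<in> ?N" by (auto simp: multiplication_iff_ns_algebra simp del: One_nat_def)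
  next
    fix x
    assume "x \<in> ?N"
    then obtain l r v where x: "x = (l, r, v)" and ns: "ns_algebra scale l r v" by auto
    let ?p = "cochain_of_ops l r v"
    have "?p \<in> OA scale 2"
      using ns by (intro cochain_of_ops_closed) (auto simp: ns_algebra_def ns_algebra_axioms_def)
    moreover have "?ops ?p = x"
      by (simp only: cochain_of_ops_basis_vec x)
    ultimately show "x \<in> ?ops ` ?M"
      using ns by (intro image_eqI[of _ _ ?p])
        (simp_all only: mem_Collect_eq multiplication_iff_ns_algebra cochain_of_ops_basis_vec simp_thms)
  qed
qed

end

theorem theorem5p1:
  fixes scale :: "'k::field_char_0 \<Rightarrow> 'a::ab_group_add \<Rightarrow> 'a"
  assumes "vector_space scale"
  shows "ns_operad (OA_scale scale) (OA scale) (OA_comp scale) (OA_id scale)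
    \<and> (\<forall>a. OA_id scale (basis_vec 1) [a] = a)
    \<and> bij_betw
        (\<lambda>p. (\<lambda>a b. p (basis_vec 1) [a, b],
              \<lambda>a b. p (basis_vec 2) [a, b],
              \<lambda>a b. p (basis_vec 3) [a, b]))
        {p \<in> OA scale 2. OA_comp scale 2 2 1 p p = OA_comp scale 2 2 2 p p}
        {(l, r, v). ns_algebra scale l r v}"
proof -
  interpret cochain_space scale
    using assms by (rule cochain_space.intro)
  show ?thesis
    using ns_operad_OA OA_id_basis_vec[OF assms] bij_betw_multiplications_ns_algebras by blast
qed

end
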